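(* Let $\phi$ be a regular binary $3$-form ($\Delta_3(\phi)\neq 0$). Then the $\mathrm{SL}_2(\mathbb{C})$-orbit of $\phi$ consists of solutions to the third order differential equation $$J_1^5+J_2^2J_1^2-16\,\Delta_3(\phi)\,J_3^2=0$$ together with $\mathcal{E}_3$. Here $\Delta_3(\phi)$ is the discriminant of the fixed form $\phi$ (a constant), and $J_1,J_2,J_3$ and $\mathcal{E}_3$ are defined in the context.
   Context: A binary $3$-form is a homogeneous polynomial of degree $3$ in $(x,y)$ on $\mathbb{C}^2$ with complex coefficients. $\mathrm{SL}_2(\mathbb{C})$ acts on functions by $A f=f\circ A^{-1}$. Jet notation: $u_{ij}$ are the canonical coordinates on the spaces of jets of functions on $\mathbb{C}^2$; on a function $f(x,y)$, $u_{ij}$ takes the value $\partial^{i+j}f/\partial x^i\partial y^j$. The total derivatives are $\frac{d}{dx}=\partial_x+\sum u_{i+1,j}\partial_{u_{ij}}$, $\frac{d}{dy}=\partial_y+\sum u_{i,j+1}\partial_{u_{ij}}$. $J_1=\Delta_2=u_{20}u_{02}-u_{11}^2$; $J_2=\nabla_1(\Delta_2)$, where $\nabla_1=u_{01}\frac{d}{dx}-u_{10}\frac{d}{dy}$; $J_3=\Delta_2\nabla_2(u_{00})$, where $\nabla_2=\frac{2(u_{02}u_{10}-u_{11}u_{01})}{\Delta_2}\frac{d}{dx}+\frac{2(u_{20}u_{01}-u_{11}u_{10})}{\Delta_2}\frac{d}{dy}$. The system $\mathcal{E}_3$ consists of the Euler equation $xu_{10}+yu_{01}=3u_{00}$, its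 total derivatives $\frac{d^{k+l}}{dx^kdy^l}(xu_{10}+yu_{01}-3u_{00})=0$ for $0\le k+l\le 2$, and the equations $u_{ij}=0$ for $i+j\ge 4$; binary $3$-forms are solutions of it. Discriminant: $\Delta_3(\phi)=\mathrm{Discr}(\phi)=\mathrm{Res}(\phi_x,\phi_y)$. The resultant of two binary forms $\alpha=\prod_i l_i$ and $\beta=\prod_j m_j$, written as products of linear forms, is $\mathrm{Res}(\alpha,\beta)=\prod_{i,j}[l_i,m_j]$, where $[l,m]=l_xm_y-l_ym_x$. *)

theory Defs
  imports "HOL-Analysis.Analysis" "HOL-Library.Groups_Big_Fun"
begin

definition binary_form :: "nat \<Rightarrow> (complex^2 \<Rightarrow> complex) \<Rightarrow> bool" where
  "binary_form n f \<longleftrightarrow>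
     (\<exists>c :: nat \<Rightarrow> complex. \<forall>v. f v = (\<Sum>k\<le>n. c k * (v $ 1) ^ k * (v $ 2) ^ (n - k)))"

definition SL2 :: "(complex^2^2) set" where
  "SL2 = {A. det A = 1}"

definition act :: "complex^2^2 \<Rightarrow> (complex^2 \<Rightarrow> complex) \<Rightarrow> complex^2 \<Rightarrow> complex" where
  "act A f = (\<lambda>v. f (matrix_inv A *v v))"

definition SL2_orbit :: "(complex^2 \<Rightarrow> complex) \<Rightarrow> (complex^2 \<Rightarrow> complex) set" where
  "SL2_orbit f = (\<lambda>A. act A f) ` SL2"

definition partial :: "2 \<Rightarrow> (complex^2 \<Rightarrow> complex) \<Rightarrow> complex^2 \<Rightarrow> complex" where
  "partial i f p = deriv (\<lambda>t. f (p + axis i t)) 0"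

definition lin_form :: "complex^2 \<Rightarrow> complex^2 \<Rightarrow> complex" where
  "lin_form l v = l $ 1 * v $ 1 + l $ 2 * v $ 2"

definition bracket :: "complex^2 \<Rightarrow> complex^2 \<Rightarrow> complex" where
  "bracket l m = l $ 1 * m $ 2 - l $ 2 * m $ 1"

text \<open>
  The arguments \<open>m\<close> and \<open>n\<close> are the degrees of the two forms; they have to be given since the
  zero form is a form of every degree.  For \<open>m, n \<ge> 1\<close> every form splits into linear factors
  and the product of brackets does not depend on the splitting: linear factors are unique up to
  order and scalars with product 1, and the product is 0 if one of the forms is 0.
\<close>

definition resultant ::
    "nat \<Rightarrow> nat \<Rightarrow> (complex^2 \<Rightarrow> complex) \<Rightarrow> (complex^2 \<Rightarrow> complex) \<Rightarrow> complex" where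
  "resultant m n \<alpha> \<beta> =
     (THE r. \<exists>a b :: nat \<Rightarrow> complex^2.
        (\<forall>v. \<alpha> v = (\<Prod>i<m. lin_form (a i) v)) \<and>
        (\<forall>v. \<beta> v = (\<Prod>j<n. lin_form (b j) v)) \<and>
        r = (\<Prod>i<m. \<Prod>j<n. bracket (a i) (b j)))"

definition discr3 :: "(complex^2 \<Rightarrow> complex) \<Rightarrow> complex" where
  "discr3 \<phi> = resultant 2 2 (partial 1 \<phi>) (partial 2 \<phi>)"

text \<open>
  A point of jet space is a base point together with the values \<open>u (i, j)\<close> of the coordinates
  \<open>u\<^sub>i\<^sub>j\<close>.  Jets of all orders are treated at once; a function on finite-order jets depends on
  only finitely many of these coordinates, so the sums in the total derivatives are finite.
\<close>

type_synonym jet = "nat \<times> nat \<Rightarrow> complex"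
type_synonym jet_fun = "complex^2 \<Rightarrow> jet \<Rightarrow> complex"

definition jet_of :: "(complex^2 \<Rightarrow> complex) \<Rightarrow> complex^2 \<Rightarrow> jet" where
  "jet_of f p = (\<lambda>(i, j). ((partial 1 ^^ i) ((partial 2 ^^ j) f)) p)"

definition jet_partial :: "nat \<times> nat \<Rightarrow> jet_fun \<Rightarrow> jet_fun" where
  "jet_partial s F = (\<lambda>p u. deriv (\<lambda>t. F p (u(s := t))) (u s))"

definition total_dx :: "jet_fun \<Rightarrow> jet_fun" where
  "total_dx F = (\<lambda>p u. partial 1 (\<lambda>q. F q u) p
     + Sum_any (\<lambda>(i, j). u (i + 1, j) * jet_partial (i, j) F p u))"

definition total_dy :: "jet_fun \<Rightarrow> jet_fun" where
  "total_dy F = (\<lambda>p u. partial 2 (\<lambda>q. F q u) p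
     + Sum_any (\<lambda>(i, j). u (i, j + 1) * jet_partial (i, j) F p u))"

definition \<Delta>\<^sub>2 :: jet_fun where
  "\<Delta>\<^sub>2 = (\<lambda>p u. u (2,0) * u (0,2) - (u (1,1))\<^sup>2)"

definition nabla1 :: "jet_fun \<Rightarrow> jet_fun" where
  "nabla1 F = (\<lambda>p u. u (0,1) * total_dx F p u - u (1,0) * total_dy F p u)"

definition nabla2 :: "jet_fun \<Rightarrow> jet_fun" where
  "nabla2 F = (\<lambda>p u.
     2 * (u (0,2) * u (1,0) - u (1,1) * u (0,1)) / \<Delta>\<^sub>2 p u * total_dx F p u
   + 2 * (u (2,0) * u (0,1) - u (1,1) * u (1,0)) / \<Delta>\<^sub>2 p u * total_dy F p u)"

definition J1 :: jet_fun where
  "J1 = \<Delta>\<^sub>2"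

definition J2 :: jet_fun where
  "J2 = nabla1 \<Delta>\<^sub>2"

text \<open>
  Since division by zero yields 0, \<open>J3\<close> is 0 wherever \<open>\<Delta>\<^sub>2\<close> is.  On jets of binary 3-forms this
  agrees with the polynomial obtained by cancelling \<open>\<Delta>\<^sub>2\<close>, which by the Euler relations
  equals \<open>3 u\<^sub>0\<^sub>0 \<Delta>\<^sub>2\<close> there.
\<close>

definition J3 :: jet_fun where
  "J3 = (\<lambda>p u. \<Delta>\<^sub>2 p u * nabla2 (\<lambda>p u. u (0,0)) p u)"

text \<open>
  Partial derivatives are arbitrary where \<open>f\<close> is not differentiable, so
  the predicates \<open>solves\<close> and \<open>solves_E3\<close> are meaningful only for holomorphic \<open>f\<close>, for instance binary forms.
\<close>

definition solves :: "jet_fun \<Rightarrow> (complex^2 \<Rightarrow> complex) \<Rightarrow> bool" where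
  "solves F f \<longleftrightarrow> (\<forall>p. F p (jet_of f p) = 0)"

definition euler3 :: jet_fun where
  "euler3 = (\<lambda>p u. p $ 1 * u (1,0) + p $ 2 * u (0,1) - 3 * u (0,0))"

definition solves_E3 :: "(complex^2 \<Rightarrow> complex) \<Rightarrow> bool" where
  "solves_E3 f \<longleftrightarrow>
     (\<forall>k l. k + l \<le> 2 \<longrightarrow> solves ((total_dx ^^ k) ((total_dy ^^ l) euler3)) f) \<and>
     (\<forall>i j. i + j \<ge> 4 \<longrightarrow> solves (\<lambda>p u. u (i, j)) f)"

definition orbit_equation :: "complex \<Rightarrow> jet_fun" where
  "orbit_equation d = (\<lambda>p u.
     (J1 p u)^5 + (J2 p u)\<^sup>2 * (J1 p u)\<^sup>2 - 16 * d * (J3 p u)\<^sup>2)"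

end

theory Submission
  imports Defs
begin

text \<open>
  Let \<open>H\<close> be the Hessian of a cubic \<open>\<psi>\<close> and \<open>T\<close> the Jacobian of \<open>\<psi>\<close> and \<open>H\<close>, both
  suitably scaled.  On the jet of \<open>\<psi>\<close> the invariants \<open>J1\<close>, \<open>J2\<close>, \<open>J3\<close> are constant multiples of
  \<open>H\<close>, \<open>T\<close>, \<open>H \<psi>\<close>, and the syzygy \<open>T\<^sup>2 + 4 H\<^sup>3 = D \<psi>\<^sup>2\<close> with \<open>81 D = discr3 \<psi>\<close> turns the orbit
  equation into \<open>(discr3 \<psi> - discr3 \<phi>) (H \<psi>)\<^sup>2 = 0\<close>.  So among regular cubics it says that the
  discriminants agree.  Regular cubics with equal discriminant are SL2-equivalent: each is
  \<open>x\<^sup>3 + y\<^sup>3\<close> in suitable coordinates, the determinants of the two coordinate changes differ by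
  a sixth root of unity, and the stabilizer of \<open>x\<^sup>3 + y\<^sup>3\<close> contains elements of each such determinant.
\<close>

section \<open>Binary forms of low degree\<close>

definition quad :: "complex \<Rightarrow> complex \<Rightarrow> complex \<Rightarrow> complex^2 \<Rightarrow> complex" where
  "quad P Q R v = P * (v $ 1)\<^sup>2 + Q * v $ 1 * v $ 2 + R * (v $ 2)\<^sup>2"

text \<open>Binomial coefficients are split off, so that the coefficients of the Hessian below are
  free of denominators.\<close>

definition cub :: "complex \<Rightarrow> complex \<Rightarrow> complex \<Rightarrow> complex \<Rightarrow> complex^2 \<Rightarrow> complex" where
  "cub a b c d v =
     a * (v $ 1) ^ 3 + 3 * b * (v $ 1)\<^sup>2 * v $ 2 + 3 * c * v $ 1 * (v $ 2)\<^sup>2 + d * (v $ 2) ^ 3"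

text \<open>This is 1/36 of the Hessian determinant of \<open>cub a b c d\<close>.\<close>

abbreviation hess :: "complex \<Rightarrow> complex \<Rightarrow> complex \<Rightarrow> complex \<Rightarrow> complex^2 \<Rightarrow> complex" where
  "hess a b c d \<equiv> quad (a * c - b\<^sup>2) (a * d - b * c) (b * d - c\<^sup>2)"

text \<open>The discriminant of the quadratic form \<open>hess a b c d\<close>; for a cubic this is,
  up to scale, its own discriminant.\<close>

definition cub_disc :: "complex \<Rightarrow> complex \<Rightarrow> complex \<Rightarrow> complex \<Rightarrow> complex" where
  "cub_disc a b c d = (a * d - b * c)\<^sup>2 - 4 * (a * c - b\<^sup>2) * (b * d - c\<^sup>2)"

lemma binary_form_3_iff: "binary_form 3 f \<longleftrightarrow> (\<exists>a b c d. f = cub a b c d)"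
proof
  assume "binary_form 3 f"
  then obtain k :: "nat \<Rightarrow> complex"
    where k: "\<And>v. f v = (\<Sum>i\<le>3. k i * (v $ 1) ^ i * (v $ 2) ^ (3 - i))"
    unfolding binary_form_def by blast
  have "f = cub (k 3) (k 2 / 3) (k 1 / 3) (k 0)"
    by (rule ext) (simp add: k cub_def eval_nat_numeral)
  then show "\<exists>a b c d. f = cub a b c d" by blast
next
  assume "\<exists>a b c d. f = cub a b c d"
  then obtain a b c d where f: "f = cub a b c d" by blast
  show "binary_form 3 f"
    unfolding binary_form_def
    by (rule exI[of _ "\<lambda>i. if i = 0 then d else if i = 1 then 3 * c else if i = 2 then 3 * b else a"])
      (simp add: f cub_def eval_nat_numeral)
qed

lemma partial_const: "partial i (\<lambda>_. k) = (\<lambda>_. 0)"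
  by (simp add: partial_def fun_eq_iff)

lemma partial_lin_form: "partial i (lin_form l) = (\<lambda>_. l $ i)"
proof
  fix p
  have "((\<lambda>t. lin_form l (p + axis i t)) has_field_derivative l $ i) (at 0)"
    using exhaust_2[of i] by (auto simp: lin_form_def axis_def intro!: derivative_eq_intros)
  then show "partial i (lin_form l) p = l $ i"
    unfolding partial_def by (rule DERIV_imp_deriv)
qed

lemma partial_quad:
  "partial 1 (quad P Q R) = lin_form (vector [2 * P, Q])"
  "partial 2 (quad P Q R) = lin_form (vector [Q, 2 * R])"
proof -
  have "((\<lambda>t. quad P Q R (p + axis 1 t)) has_field_derivative lin_form (vector [2 * P, Q]) p) (at 0)"
    and "((\<lambda>t. quad P Q R (p + axis 2 t)) has_field_derivative lin_form (vector [Q, 2 * R]) p) (at 0)"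
    for p
    by (auto simp: lin_form_def quad_def axis_def algebra_simps intro!: derivative_eq_intros)
  then show
    "partial 1 (quad P Q R) = lin_form (vector [2 * P, Q])"
    "partial 2 (quad P Q R) = lin_form (vector [Q, 2 * R])"
    by (auto simp: partial_def fun_eq_iff intro: DERIV_imp_deriv)
qed

lemma partial_cub:
  "partial 1 (cub a b c d) = quad (3 * a) (6 * b) (3 * c)"
  "partial 2 (cub a b c d) = quad (3 * b) (6 * c) (3 * d)"
proof -
  have "((\<lambda>t. cub a b c d (p + axis 1 t)) has_field_derivative quad (3 * a) (6 * b) (3 * c) p) (at 0)"
    and "((\<lambda>t. cub a b c d (p + axis 2 t)) has_field_derivative quad (3 * b) (6 * c) (3 * d) p) (at 0)"
    for p
    by (auto simp: cub_def quad_def axis_def algebra_simps intro!: derivative_eq_intros)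
  then show
    "partial 1 (cub a b c d) = quad (3 * a) (6 * b) (3 * c)"
    "partial 2 (cub a b c d) = quad (3 * b) (6 * c) (3 * d)"
    by (auto simp: partial_def fun_eq_iff intro: DERIV_imp_deriv)
qed

section \<open>Resultant and discriminant\<close>

text \<open>The quadratic formula, with \<open>csqrt\<close> providing the root. For P = 0 the
  variable y splits off.\<close>

lemma quad_factor: "\<exists>\<alpha> \<beta>. \<forall>v. quad P Q R v = lin_form \<alpha> v * lin_form \<beta> v"
proof (cases "P = 0")
  case True
  then have "\<forall>v. quad P Q R v = lin_form (vector [0, 1]) v * lin_form (vector [Q, R]) v"
    by (simp add: quad_def lin_form_def algebra_simps power2_eq_square)
  then show ?thesis by blast
next
  case False
  define s where "s = csqrt (Q\<^sup>2 - 4 * P * R)"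
  have s: "s\<^sup>2 = Q\<^sup>2 - 4 * P * R"
    by (simp add: s_def)
  have "quad P Q R v = lin_form (vector [P, (Q + s) / 2]) v * lin_form (vector [1, (Q - s) / (2 * P)]) v"
    for v
  proof -
    have "(Q + s) / 2 * ((Q - s) / (2 * P)) = (Q\<^sup>2 - s\<^sup>2) / (4 * P)"
      by (simp add: field_simps power2_eq_square)
    also have "\<dots> = R"
      using False by (simp add: s)
    finally have R: "R = (Q + s) / 2 * ((Q - s) / (2 * P))" ..
    show ?thesis
      unfolding R quad_def lin_form_def using False
      by (simp add: divide_simps) (simp add: algebra_simps power2_eq_square)
  qed
  then show ?thesis by blast
qed

lemma quad_eq_lin_prodD:
  assumes "\<And>v. quad P Q R v = lin_form \<alpha> v * lin_form \<beta> v"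
  shows "P = \<alpha> $ 1 * \<beta> $ 1" "Q = \<alpha> $ 1 * \<beta> $ 2 + \<alpha> $ 2 * \<beta> $ 1" "R = \<alpha> $ 2 * \<beta> $ 2"
proof -
  show P: "P = \<alpha> $ 1 * \<beta> $ 1"
    using assms[of "vector [1, 0]"] by (simp add: quad_def lin_form_def)
  show R: "R = \<alpha> $ 2 * \<beta> $ 2"
    using assms[of "vector [0, 1]"] by (simp add: quad_def lin_form_def)
  show "Q = \<alpha> $ 1 * \<beta> $ 2 + \<alpha> $ 2 * \<beta> $ 1"
    using assms[of "vector [1, 1]"] by (simp add: P R quad_def lin_form_def algebra_simps)
qed

text \<open>The right-hand side is the Sylvester determinant. Any splitting into linear factors
  gives this polynomial in the coefficients, hence uniqueness for \<open>THE\<close>; existence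
  comes from \<open>quad_factor\<close>.\<close>

lemma resultant_quad:
  "resultant 2 2 (quad A B C) (quad A' B' C') =
     (A * C' - C * A')\<^sup>2 - (A * B' - B * A') * (B * C' - C * B')" (is "_ = ?r")
proof -
  have two: "(\<Prod>i<2. f i) = f 0 * f (Suc 0)" for f :: "nat \<Rightarrow> complex"
    by (simp add: numeral_2_eq_2)
  show ?thesis
    unfolding resultant_def two
  proof (rule the_equality)
    obtain \<alpha> \<alpha>' where \<alpha>: "\<And>v. quad A B C v = lin_form \<alpha> v * lin_form \<alpha>' v"
      using quad_factor by blast
    obtain \<beta> \<beta>' where \<beta>: "\<And>v. quad A' B' C' v = lin_form \<beta> v * lin_form \<beta>' v"
      using quad_factor by blast
    show "\<exists>a b. (\<forall>v. quad A B C v = lin_form (a 0) v * lin_form (a (Suc 0)) v) \<and>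
        (\<forall>v. quad A' B' C' v = lin_form (b 0) v * lin_form (b (Suc 0)) v) \<and>
        ?r = bracket (a 0) (b 0) * bracket (a 0) (b (Suc 0)) *
             (bracket (a (Suc 0)) (b 0) * bracket (a (Suc 0)) (b (Suc 0)))"
    proof (intro exI conjI allI)
      let ?a = "\<lambda>i::nat. if i = 0 then \<alpha> else \<alpha>'" and ?b = "\<lambda>i::nat. if i = 0 then \<beta> else \<beta>'"
      show "quad A B C v = lin_form (?a 0) v * lin_form (?a (Suc 0)) v" for v
        by (simp add: \<alpha>)
      show "quad A' B' C' v = lin_form (?b 0) v * lin_form (?b (Suc 0)) v" for v
        by (simp add: \<beta>)
      have "?r = bracket \<alpha> \<beta> * bracket \<alpha> \<beta>' * (bracket \<alpha>' \<beta> * bracket \<alpha>' \<beta>')"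
        unfolding quad_eq_lin_prodD[OF \<alpha>] quad_eq_lin_prodD[OF \<beta>] bracket_def by algebra
      then show "?r = bracket (?a 0) (?b 0) * bracket (?a 0) (?b (Suc 0)) *
          (bracket (?a (Suc 0)) (?b 0) * bracket (?a (Suc 0)) (?b (Suc 0)))"
        by simp
    qed
  next
    fix r
    assume "\<exists>a b. (\<forall>v. quad A B C v = lin_form (a 0) v * lin_form (a (Suc 0)) v) \<and>
        (\<forall>v. quad A' B' C' v = lin_form (b 0) v * lin_form (b (Suc 0)) v) \<and>
        r = bracket (a 0) (b 0) * bracket (a 0) (b (Suc 0)) *
             (bracket (a (Suc 0)) (b 0) * bracket (a (Suc 0)) (b (Suc 0)))"
    then obtain a b where a: "\<And>v. quad A B C v = lin_form (a 0) v * lin_form (a (Suc 0)) v"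
      and b: "\<And>v. quad A' B' C' v = lin_form (b 0) v * lin_form (b (Suc 0)) v"
      and r: "r = bracket (a 0) (b 0) * bracket (a 0) (b (Suc 0)) *
             (bracket (a (Suc 0)) (b 0) * bracket (a (Suc 0)) (b (Suc 0)))"
      by blast
    show "r = ?r"
      unfolding r quad_eq_lin_prodD[OF a] quad_eq_lin_prodD[OF b] bracket_def by algebra
  qed
qed

text \<open>Both partial derivatives carry a factor 3 and the resultant has degree 4 in their
  coefficients together, whence 81 = 3^4.\<close>

lemma discr3_cub: "discr3 (cub a b c d) = 81 * cub_disc a b c d"
  unfolding discr3_def partial_cub resultant_quad cub_disc_def by algebra

section \<open>Linear substitutions\<close>

text \<open>The Hessian is a covariant of weight 2. Its discriminant gains (det g)^4 from the scalar
  factor and (det g)^2 from the substitution, so \<open>cub_disc\<close> has weight 6.\<close>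

lemma cub_subst:
  fixes g :: "complex^2^2"
  obtains a' b' c' d' where
    "\<And>v. cub a b c d (g *v v) = cub a' b' c' d' v"
    "\<And>v. hess a' b' c' d' v = (det g)\<^sup>2 * hess a b c d (g *v v)"
    "cub_disc a' b' c' d' = det g ^ 6 * cub_disc a b c d"
proof -
  define p q r s where pqrs: "p = g $ 1 $ 1" "q = g $ 1 $ 2" "r = g $ 2 $ 1" "s = g $ 2 $ 2"
  define a' b' c' d' where coeffs:
    "a' = a * p^3 + 3 * b * p\<^sup>2 * r + 3 * c * p * r\<^sup>2 + d * r^3"
    "b' = a * p\<^sup>2 * q + b * (p\<^sup>2 * s + 2 * p * q * r) + c * (2 * p * r * s + q * r\<^sup>2) + d * r\<^sup>2 * s"
    "c' = a * p * q\<^sup>2 + b * (2 * p * q * s + q\<^sup>2 * r) + c * (p * s\<^sup>2 + 2 * q * r * s) + d * r * s\<^sup>2"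
    "d' = a * q^3 + 3 * b * q\<^sup>2 * s + 3 * c * q * s\<^sup>2 + d * s^3"
  define P Q R where PQR: "P = a * c - b\<^sup>2" "Q = a * d - b * c" "R = b * d - c\<^sup>2"
  \<comment> \<open>The new Hessian coefficients are expressed through P, Q, R, which keeps the
    final polynomial identities small.\<close>
  have P': "a' * c' - b'\<^sup>2 = (p * s - q * r)\<^sup>2 * (P * p\<^sup>2 + Q * p * r + R * r\<^sup>2)"
    unfolding coeffs PQR by algebra
  have Q': "a' * d' - b' * c' =
      (p * s - q * r)\<^sup>2 * (2 * P * p * q + Q * (p * s + q * r) + 2 * R * r * s)"
    unfolding coeffs PQR by algebra
  have R': "b' * d' - c'\<^sup>2 = (p * s - q * r)\<^sup>2 * (P * q\<^sup>2 + Q * q * s + R * s\<^sup>2)"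
    unfolding coeffs PQR by algebra
  have g: "(g *v v) $ 1 = p * v $ 1 + q * v $ 2" "(g *v v) $ 2 = r * v $ 1 + s * v $ 2" for v
    by (simp_all add: matrix_vector_mult_def sum_2 pqrs)
  have det: "det g = p * s - q * r"
    by (simp add: det_2 pqrs)
  show thesis
  proof
    show "cub a b c d (g *v v) = cub a' b' c' d' v" for v
      unfolding cub_def g coeffs by algebra
    show "hess a' b' c' d' v = (det g)\<^sup>2 * hess a b c d (g *v v)" for v
      unfolding P' Q' R' unfolding PQR[symmetric] quad_def g det by algebra
    show "cub_disc a' b' c' d' = det g ^ 6 * cub_disc a b c d"
      unfolding cub_disc_def P' Q' R' unfolding PQR[symmetric] det by algebra
  qed
qed

lemma cub_eq_iff: "cub a b c d = cub a' b' c' d' \<longleftrightarrow> a = a' \<and> b = b' \<and> c = c' \<and> d = d'"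
proof
  assume eq: "cub a b c d = cub a' b' c' d'"
  have a: "a = a'" using fun_cong[OF eq, of "vector [1, 0]"] by (simp add: cub_def)
  have d: "d = d'" using fun_cong[OF eq, of "vector [0, 1]"] by (simp add: cub_def)
  have "3 * b + 3 * c = 3 * b' + 3 * c'"
    using fun_cong[OF eq, of "vector [1, 1]"] by (simp add: cub_def a d)
  moreover have "3 * c - 3 * b = 3 * c' - 3 * b'"
    using fun_cong[OF eq, of "vector [1, -1]"] by (simp add: cub_def a d)
  ultimately have "6 * b = 6 * b'" "6 * c = 6 * c'"
    by algebra+
  then show "a = a' \<and> b = b' \<and> c = c' \<and> d = d'"
    using a d by simp
qed simp

text \<open>\<open>cub_subst\<close> yields some coefficients of the transformed cubic; as a cubic
  determines its coefficients, the formulas hold for any given ones.\<close>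

lemma hess_cub_subst:
  fixes g :: "complex^2^2"
  assumes "\<And>v. cub a b c d (g *v v) = cub a' b' c' d' v"
  shows "hess a' b' c' d' v = (det g)\<^sup>2 * hess a b c d (g *v v)"
    and "cub_disc a' b' c' d' = det g ^ 6 * cub_disc a b c d"
proof -
  obtain a1 b1 c1 d1 where *: "\<And>v. cub a b c d (g *v v) = cub a1 b1 c1 d1 v"
    "\<And>v. hess a1 b1 c1 d1 v = (det g)\<^sup>2 * hess a b c d (g *v v)"
    "cub_disc a1 b1 c1 d1 = det g ^ 6 * cub_disc a b c d"
    by (rule cub_subst[of a b c d g]) blast
  have "cub a' b' c' d' = cub a1 b1 c1 d1"
    using assms *(1) by (auto simp: fun_eq_iff)
  then have "a' = a1" "b' = b1" "c' = c1" "d' = d1"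
    by (auto simp: cub_eq_iff)
  with *(2,3) show "hess a' b' c' d' v = (det g)\<^sup>2 * hess a b c d (g *v v)"
    and "cub_disc a' b' c' d' = det g ^ 6 * cub_disc a b c d"
    by auto
qed

text \<open>The two linear factors of the Hessian are the forms whose cubes add up to the given form.\<close>

lemma cub_normal_form:
  assumes "cub_disc a b c d \<noteq> 0"
  obtains g :: "complex^2^2" where "det g \<noteq> 0" "\<And>v. cub a b c d (g *v v) = cub 1 0 0 1 v"
proof -
  obtain \<alpha> \<beta> where \<alpha>\<beta>: "\<And>v. hess a b c d v = lin_form \<alpha> v * lin_form \<beta> v"
    using quad_factor by blast
  define \<delta> where "\<delta> = bracket \<alpha> \<beta>"
  \<comment> \<open>The discriminant of a product of two linear forms is their squared bracket, so
    the factors are independent.\<close>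
  have "cub_disc a b c d = \<delta>\<^sup>2"
    unfolding \<delta>_def cub_disc_def mult.assoc quad_eq_lin_prodD[OF \<alpha>\<beta>] bracket_def by algebra
  then have \<delta>: "\<delta> \<noteq> 0" using assms by auto
  \<comment> \<open>The inverse of the matrix with rows \<alpha> and \<beta>: it makes these forms
    the new coordinates, and the Hessian a multiple of xy.\<close>
  define h :: "complex^2^2" where
    "h = vector [vector [\<beta> $ 2 / \<delta>, - \<alpha> $ 2 / \<delta>], vector [- \<beta> $ 1 / \<delta>, \<alpha> $ 1 / \<delta>]]"
  have hv: "(h *v v) $ 1 = (\<beta> $ 2 * v $ 1 - \<alpha> $ 2 * v $ 2) / \<delta>"
    "(h *v v) $ 2 = (\<alpha> $ 1 * v $ 2 - \<beta> $ 1 * v $ 1) / \<delta>" for v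
    by (simp_all add: h_def matrix_vector_mult_def sum_2 diff_divide_distrib)
  have lin: "lin_form \<alpha> (h *v v) = v $ 1" "lin_form \<beta> (h *v v) = v $ 2" for v
    using \<delta> unfolding lin_form_def hv
    by (simp_all add: field_simps) (simp_all add: \<delta>_def bracket_def algebra_simps)
  have "det h = \<delta> / \<delta>\<^sup>2"
    by (simp add: h_def det_2 \<delta>_def bracket_def diff_divide_distrib power2_eq_square mult.commute)
  then have det_h: "det h \<noteq> 0" using \<delta> by simp
  obtain a' b' c' d' where
    sub: "\<And>v. cub a b c d (h *v v) = cub a' b' c' d' v" and
    hess: "\<And>v. hess a' b' c' d' v = (det h)\<^sup>2 * hess a b c d (h *v v)" and
    disc: "cub_disc a' b' c' d' = det h ^ 6 * cub_disc a b c d"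
    by (rule cub_subst[of a b c d h]) blast
  have hess': "hess a' b' c' d' v = (det h)\<^sup>2 * (v $ 1 * v $ 2)" for v
    by (simp add: hess \<alpha>\<beta> lin)
  have P: "a' * c' = b'\<^sup>2"
    using hess'[of "vector [1, 0]"] by (simp add: quad_def)
  have R: "b' * d' = c'\<^sup>2"
    using hess'[of "vector [0, 1]"] by (simp add: quad_def)
  have "cub_disc a' b' c' d' \<noteq> 0"
    using disc assms det_h by simp
  then have Q: "a' * d' - b' * c' \<noteq> 0"
    by (simp add: cub_disc_def P R)
  \<comment> \<open>Multiplying P and R gives a'c'b'd' = (b'c')^2. Hence b' or c' vanishes, and by P
    or R so does the other.\<close>
  have "b' * c' * (a' * d' - b' * c') = 0"
    using P R by algebra
  then have "b' = 0 \<and> c' = 0"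
    using P R Q by auto
  then have b': "b' = 0" and c': "c' = 0" by auto
  with Q have "a' \<noteq> 0" "d' \<noteq> 0" by auto
  obtain w where w: "a' = w ^ 3"
    using exists_complex_root[of 3 a'] by auto
  obtain z where z: "d' = z ^ 3"
    using exists_complex_root[of 3 d'] by auto
  have wz: "w \<noteq> 0" "z \<noteq> 0"
    using \<open>a' \<noteq> 0\<close> \<open>d' \<noteq> 0\<close> by (auto simp: w z)
  \<comment> \<open>Only the two pure cubes are left; dividing the variables by cube roots of their
    coefficients makes these 1.\<close>
  define k :: "complex^2^2" where "k = vector [vector [1 / w, 0], vector [0, 1 / z]]"
  have kv: "(k *v v) $ 1 = v $ 1 / w" "(k *v v) $ 2 = v $ 2 / z" for v
    by (simp_all add: k_def matrix_vector_mult_def sum_2)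
  show thesis
  proof
    show "det (h ** k) \<noteq> 0"
      using det_h wz by (simp add: det_mul) (simp add: k_def det_2)
    show "cub a b c d ((h ** k) *v v) = cub 1 0 0 1 v" for v
      unfolding matrix_vector_mul_assoc[symmetric] sub
      using wz by (simp add: cub_def kv b' c' w z power_divide)
  qed
qed

section \<open>Jets of cubic forms\<close>

lemma jet_of_cub:
  "jet_of (cub a b c d) p (0, 0) = cub a b c d p"
  "jet_of (cub a b c d) p (1, 0) = quad (3 * a) (6 * b) (3 * c) p"
  "jet_of (cub a b c d) p (0, 1) = quad (3 * b) (6 * c) (3 * d) p"
  "jet_of (cub a b c d) p (2, 0) = 6 * (a * p $ 1 + b * p $ 2)"
  "jet_of (cub a b c d) p (1, 1) = 6 * (b * p $ 1 + c * p $ 2)"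
  "jet_of (cub a b c d) p (0, 2) = 6 * (c * p $ 1 + d * p $ 2)"
  "jet_of (cub a b c d) p (3, 0) = 6 * a"
  "jet_of (cub a b c d) p (2, 1) = 6 * b"
  "jet_of (cub a b c d) p (1, 2) = 6 * c"
  "jet_of (cub a b c d) p (0, 3) = 6 * d"
  by (simp_all add: jet_of_def eval_nat_numeral partial_cub partial_quad partial_lin_form)
    (simp_all add: lin_form_def algebra_simps)

lemma jet_of_cub_ge_4:
  assumes "i + j \<ge> 4"
  shows "jet_of (cub a b c d) p (i, j) = 0"
proof -
  have zero: "(partial k ^^ n) (\<lambda>_. 0) = (\<lambda>_. 0)" for k n
    by (induction n) (simp_all add: partial_const)
  note partials = zero partial_cub partial_quad partial_lin_form partial_const
  \<comment> \<open>In \<open>jet_of\<close> the y-derivatives act first and leave a form of degree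
    3 - j. The next 4 - j x-derivatives annihilate it, and the remaining k act on zero.\<close>
  consider "j = 0" | "j = 1" | "j = 2" | "j = 3" | "j \<ge> 4" by linarith
  then have "(partial 1 ^^ i) ((partial 2 ^^ j) (cub a b c d)) = (\<lambda>_. 0)"
  proof cases
    case 1
    then obtain k where i: "i = k + 4" using assms nat_le_iff_add[of 4 i] by (auto simp: add.commute)
    show ?thesis
      unfolding i 1 funpow_add comp_apply by (simp add: eval_nat_numeral partials)
  next
    case 2
    then obtain k where i: "i = k + 3" using assms nat_le_iff_add[of 3 i] by (auto simp: add.commute)
    show ?thesis
      unfolding i 2 funpow_add comp_apply by (simp add: eval_nat_numeral partials)
  next
    case 3
    then obtain k where i: "i = k + 2" using assms nat_le_iff_add[of 2 i] by (auto simp: add.commute)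
    show ?thesis
      unfolding i 3 funpow_add comp_apply by (simp add: eval_nat_numeral partials)
  next
    case 4
    then obtain k where i: "i = k + 1" using assms nat_le_iff_add[of 1 i] by (auto simp: add.commute)
    show ?thesis
      unfolding i 4 funpow_add comp_apply by (simp add: eval_nat_numeral partials)
  next
    case 5
    then obtain k where j: "j = k + 4" using nat_le_iff_add[of 4 j] by (auto simp: add.commute)
    show ?thesis
      unfolding j funpow_add comp_apply by (simp add: eval_nat_numeral partials)
  qed
  then show ?thesis by (simp add: jet_of_def)
qed

section \<open>Total derivatives\<close>

lemma jet_partial_eq_0:
  assumes "\<And>t. F p (u(s := t)) = F p u"
  shows "jet_partial s F p u = 0"
  by (simp add: jet_partial_def assms)

text \<open>\<open>Sum_any\<close> runs over the support of its summand, so any finite set of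
  coordinates containing those that matter may replace it.\<close>

lemma total_derivatives_finite:
  assumes "finite S" "\<And>s. s \<notin> S \<Longrightarrow> jet_partial s F p u = 0"
  shows "total_dx F p u =
      partial 1 (\<lambda>q. F q u) p + (\<Sum>s\<in>S. u (fst s + 1, snd s) * jet_partial s F p u)"
    and "total_dy F p u =
      partial 2 (\<lambda>q. F q u) p + (\<Sum>s\<in>S. u (fst s, snd s + 1) * jet_partial s F p u)"
proof -
  show "total_dx F p u =
      partial 1 (\<lambda>q. F q u) p + (\<Sum>s\<in>S. u (fst s + 1, snd s) * jet_partial s F p u)"
    unfolding total_dx_def
    by (subst Sum_any.expand_superset[OF assms(1)]) (use assms(2) in \<open>auto simp: case_prod_unfold\<close>)
  show "total_dy F p u =
      partial 2 (\<lambda>q. F q u) p + (\<Sum>s\<in>S. u (fst s, snd s + 1) * jet_partial s F p u)"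
    unfolding total_dy_def
    by (subst Sum_any.expand_superset[OF assms(1)]) (use assms(2) in \<open>auto simp: case_prod_unfold\<close>)
qed

lemma jet_partialI:
  assumes "((\<lambda>t. F p (u(s := t))) has_field_derivative D) (at (u s))"
  shows "jet_partial s F p u = D"
  unfolding jet_partial_def using assms by (rule DERIV_imp_deriv)

lemma total_derivatives_coord:
  "total_dx (\<lambda>p u. u (i, j)) p u = u (i + 1, j)"
  "total_dy (\<lambda>p u. u (i, j)) p u = u (i, j + 1)"
proof -
  have one: "jet_partial (i, j) (\<lambda>p u. u (i, j)) p u = 1"
    by (rule jet_partialI) simp
  have zero: "jet_partial s (\<lambda>p u. u (i, j)) p u = 0" if "s \<notin> {(i, j)}" for s
    by (rule jet_partial_eq_0) (use that in auto)
  show "total_dx (\<lambda>p u. u (i, j)) p u = u (i + 1, j)"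
    "total_dy (\<lambda>p u. u (i, j)) p u = u (i, j + 1)"
    using total_derivatives_finite[where S = "{(i, j)}", OF _ zero] one by (simp_all add: partial_const)
qed

lemma total_derivatives_Delta2:
  "total_dx \<Delta>\<^sub>2 p u = u (3, 0) * u (0, 2) + u (1, 2) * u (2, 0) - 2 * u (2, 1) * u (1, 1)"
  "total_dy \<Delta>\<^sub>2 p u = u (2, 1) * u (0, 2) + u (0, 3) * u (2, 0) - 2 * u (1, 2) * u (1, 1)"
proof -
  have d20: "jet_partial (2, 0) \<Delta>\<^sub>2 p u = u (0, 2)"
    by (rule jet_partialI) (auto simp: \<Delta>\<^sub>2_def intro!: derivative_eq_intros)
  have d02: "jet_partial (0, 2) \<Delta>\<^sub>2 p u = u (2, 0)"
    by (rule jet_partialI) (auto simp: \<Delta>\<^sub>2_def intro!: derivative_eq_intros)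
  have d11: "jet_partial (1, 1) \<Delta>\<^sub>2 p u = - 2 * u (1, 1)"
    by (rule jet_partialI) (auto simp: \<Delta>\<^sub>2_def intro!: derivative_eq_intros)
  have zero: "jet_partial s \<Delta>\<^sub>2 p u = 0" if "s \<notin> {(2, 0), (0, 2), (1, 1)}" for s
    by (rule jet_partial_eq_0) (use that in \<open>auto simp: \<Delta>\<^sub>2_def\<close>)
  have const: "partial i (\<lambda>q. \<Delta>\<^sub>2 q u) p = 0" for i
    by (simp add: \<Delta>\<^sub>2_def partial_const)
  show
    "total_dx \<Delta>\<^sub>2 p u = u (3, 0) * u (0, 2) + u (1, 2) * u (2, 0) - 2 * u (2, 1) * u (1, 1)"
    "total_dy \<Delta>\<^sub>2 p u = u (2, 1) * u (0, 2) + u (0, 3) * u (2, 0) - 2 * u (1, 2) * u (1, 1)"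
    using total_derivatives_finite[where S = "{(2, 0), (0, 2), (1, 1)}", OF _ zero] d20 d02 d11
    by (simp_all add: const eval_nat_numeral)
qed

text \<open>Euler's relation for a derivative of order k + l of a cubic, which is homogeneous of
  degree 3 - (k + l).\<close>

definition euler_jet :: "nat \<Rightarrow> nat \<Rightarrow> jet_fun" where
  "euler_jet k l = (\<lambda>p u. p $ 1 * u (k + 1, l) + p $ 2 * u (k, l + 1) + (of_nat (k + l) - 3) * u (k, l))"

text \<open>Differentiating the explicit factor x or y contributes one more copy of the shifted
  coordinate, which raises the constant by 1.\<close>

lemma total_derivatives_euler_jet:
  "total_dx (euler_jet k l) = euler_jet (Suc k) l"
  "total_dy (euler_jet k l) = euler_jet k (Suc l)"
proof -
  have d10: "jet_partial (Suc k, l) (euler_jet k l) p u = p $ 1" for p u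
    by (rule jet_partialI) (auto simp: euler_jet_def intro!: derivative_eq_intros)
  have d01: "jet_partial (k, Suc l) (euler_jet k l) p u = p $ 2" for p u
    by (rule jet_partialI) (auto simp: euler_jet_def intro!: derivative_eq_intros)
  have d00: "jet_partial (k, l) (euler_jet k l) p u = of_nat (k + l) - 3" for p u
    by (rule jet_partialI) (auto simp: euler_jet_def intro!: derivative_eq_intros)
  have zero: "jet_partial s (euler_jet k l) p u = 0"
    if "s \<notin> {(Suc k, l), (k, Suc l), (k, l)}" for s p u
    by (rule jet_partial_eq_0) (use that in \<open>auto simp: euler_jet_def\<close>)
  have p1: "partial 1 (\<lambda>q. euler_jet k l q u) p = u (Suc k, l)" for p u
    unfolding partial_def
    by (rule DERIV_imp_deriv) (auto simp: euler_jet_def axis_def intro!: derivative_eq_intros)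
  have p2: "partial 2 (\<lambda>q. euler_jet k l q u) p = u (k, Suc l)" for p u
    unfolding partial_def
    by (rule DERIV_imp_deriv) (auto simp: euler_jet_def axis_def intro!: derivative_eq_intros)
  show "total_dx (euler_jet k l) = euler_jet (Suc k) l"
    by (intro ext, subst total_derivatives_finite(1)[where S = "{(Suc k, l), (k, Suc l), (k, l)}", OF _ zero])
      (simp_all add: p1 d10 d01 d00, simp add: euler_jet_def algebra_simps)
  show "total_dy (euler_jet k l) = euler_jet k (Suc l)"
    by (intro ext, subst total_derivatives_finite(2)[where S = "{(Suc k, l), (k, Suc l), (k, l)}", OF _ zero])
      (simp_all add: p2 d10 d01 d00, simp add: euler_jet_def algebra_simps)
qed

lemma total_derivatives_euler3: "(total_dx ^^ k) ((total_dy ^^ l) euler3) = euler_jet k l"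
proof -
  have "(total_dy ^^ l) euler3 = euler_jet 0 l"
  proof (induction l)
    case 0
    show ?case by (simp add: euler3_def euler_jet_def)
  qed (simp add: total_derivatives_euler_jet)
  then show ?thesis
    by (induction k) (simp_all add: total_derivatives_euler_jet)
qed

lemma solves_E3_cub: "solves_E3 (cub a b c d)"
proof -
  have "euler_jet k l p (jet_of (cub a b c d) p) = 0" if "k + l \<le> 2" for k l p
  proof -
    have "k = 0 \<and> l = 0 \<or> k = 1 \<and> l = 0 \<or> k = 0 \<and> l = 1
        \<or> k = 2 \<and> l = 0 \<or> k = 1 \<and> l = 1 \<or> k = 0 \<and> l = 2"
      using that by arith
    then show ?thesis
      using jet_of_cub[of a b c d p]
      by (elim disjE conjE) (simp_all add: euler_jet_def eval_nat_numeral,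
        simp_all add: cub_def quad_def algebra_simps eval_nat_numeral)
  qed
  then show ?thesis
    by (auto simp: solves_E3_def solves_def total_derivatives_euler3 jet_of_cub_ge_4)
qed

section \<open>The orbit equation\<close>

lemma J1_cub: "J1 p (jet_of (cub a b c d) p) = 36 * hess a b c d p"
  unfolding J1_def \<Delta>\<^sub>2_def jet_of_cub quad_def by algebra

text \<open>Both sides vanish with \<open>\<Delta>\<^sub>2\<close>. Elsewhere the denominators
  cancel and a polynomial identity in the coefficients and the point remains.\<close>

lemma J3_cub: "J3 p (jet_of (cub a b c d) p) = 108 * hess a b c d p * cub a b c d p"
proof -
  define u where "u = jet_of (cub a b c d) p"
  have u: "u (0,0) = cub a b c d p"
    "u (1,0) = quad (3 * a) (6 * b) (3 * c) p" "u (0,1) = quad (3 * b) (6 * c) (3 * d) p"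
    "u (2,0) = 6 * (a * p $ 1 + b * p $ 2)" "u (1,1) = 6 * (b * p $ 1 + c * p $ 2)"
    "u (0,2) = 6 * (c * p $ 1 + d * p $ 2)"
    unfolding u_def jet_of_cub by simp_all
  have D: "\<Delta>\<^sub>2 p u = 36 * hess a b c d p"
    using J1_cub[of p a b c d] by (simp add: J1_def u_def)
  show ?thesis
  proof (cases "\<Delta>\<^sub>2 p u = 0")
    case True
    with D show ?thesis by (simp add: J3_def flip: u_def)
  next
    case False
    then have "J3 p u = 2 * (u (0,2) * u (1,0) - u (1,1) * u (0,1)) * u (1,0)
        + 2 * (u (2,0) * u (0,1) - u (1,1) * u (1,0)) * u (0,1)"
      by (simp add: J3_def nabla2_def total_derivatives_coord distrib_left)
    also have "\<dots> = 108 * hess a b c d p * cub a b c d p"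
      unfolding u quad_def cub_def by algebra
    finally show ?thesis by (simp add: u_def)
  qed
qed

text \<open>The classical syzygy between the covariants of a cubic.  Up to constants \<open>J2\<close> is the polar
  bilinear form of the Hessian at \<open>p\<close> and the skew gradient of the cubic, so its square is given by
  the discriminant identity \<open>disc\<close>.\<close>

lemma syzygy_cub:
  "4 * hess a b c d p ^ 3 + (J2 p (jet_of (cub a b c d) p) / 108)\<^sup>2 =
     cub_disc a b c d * (cub a b c d p)\<^sup>2"
proof -
  define x y where xy: "x = p $ 1" "y = p $ 2"
  \<comment> \<open>A and B are one third of the partial derivatives of the cubic.\<close>
  define A B where AB: "A = a * x\<^sup>2 + 2 * b * x * y + c * y\<^sup>2" "B = b * x\<^sup>2 + 2 * c * x * y + d * y\<^sup>2"
  define P Q R where PQR: "P = a * c - b\<^sup>2" "Q = a * d - b * c" "R = b * d - c\<^sup>2"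
  define H where "H = P * x\<^sup>2 + Q * x * y + R * y\<^sup>2"
  define T where "T = B * (2 * P * x + Q * y) - A * (Q * x + 2 * R * y)"
  have J2: "J2 p (jet_of (cub a b c d) p) = 108 * T"
    unfolding J2_def nabla1_def total_derivatives_Delta2 jet_of_cub quad_def T_def AB xy PQR
    by algebra
  have f: "cub a b c d p = x * A + y * B"
    unfolding cub_def AB xy by algebra
  \<comment> \<open>The left side is the Hessian form evaluated at the skew gradient (B,
    -A).\<close>
  have skew: "P * B\<^sup>2 - Q * A * B + R * A\<^sup>2 = - H\<^sup>2"
    unfolding H_def AB PQR by algebra
  \<comment> \<open>A quadratic form q with b(v,w) = q(v+w) - q(v) - q(w) satisfies b(v,w)^2 - 4
    q(v) q(w) = disc(q) det(v,w)^2. Here v = (x, y) and w = (B, -A), with determinant -(xA +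
    yB).\<close>
  have disc: "T\<^sup>2 - 4 * H * (P * B\<^sup>2 - Q * A * B + R * A\<^sup>2) = (Q\<^sup>2 - 4 * P * R) * (x * A + y * B)\<^sup>2"
    unfolding H_def T_def by algebra
  have "4 * H ^ 3 + T\<^sup>2 = (Q\<^sup>2 - 4 * P * R) * (x * A + y * B)\<^sup>2"
    using disc unfolding skew by algebra
  then show ?thesis
    by (simp add: J2 f cub_disc_def quad_def H_def PQR flip: xy)
qed

text \<open>Since 36^3 = 4 * 108^2, the first two terms are a multiple of the left side of the
  syzygy; 16 = 36^2 / 81 matches the factor between \<open>discr3\<close> and
  \<open>cub_disc\<close>.\<close>

lemma orbit_equation_cub:
  "orbit_equation \<delta> p (jet_of (cub a b c d) p) =
     (36 * 108 * hess a b c d p * cub a b c d p)\<^sup>2 * (cub_disc a b c d - \<delta> / 81)"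
proof -
  define H T f D where HTfD: "H = hess a b c d p" "T = J2 p (jet_of (cub a b c d) p) / 108"
    "f = cub a b c d p" "D = cub_disc a b c d"
  have syz: "4 * H ^ 3 + T\<^sup>2 = D * f\<^sup>2"
    unfolding HTfD by (rule syzygy_cub)
  have J2: "J2 p (jet_of (cub a b c d) p) = 108 * T"
    by (simp add: HTfD)
  have "orbit_equation \<delta> p (jet_of (cub a b c d) p) =
      (36 * H)^5 + (108 * T)\<^sup>2 * (36 * H)\<^sup>2 - 16 * \<delta> * (108 * H * f)\<^sup>2"
    unfolding orbit_equation_def J1_cub J2 J3_cub unfolding HTfD ..
  also have "\<dots> = (36 * 108)\<^sup>2 * H\<^sup>2 * (4 * H ^ 3 + T\<^sup>2) - 16 * \<delta> * (108 * H * f)\<^sup>2"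
    by (simp add: power_mult_distrib algebra_simps eval_nat_numeral)
  also have "\<dots> = (36 * 108 * H * f)\<^sup>2 * (D - \<delta> / 81)"
    unfolding syz by (simp add: power_mult_distrib algebra_simps)
  finally show ?thesis unfolding HTfD .
qed

lemma solves_orbit_equation_cub_iff:
  assumes "cub_disc a b c d \<noteq> 0"
  shows "solves (orbit_equation \<delta>) (cub a b c d) \<longleftrightarrow> discr3 (cub a b c d) = \<delta>"
proof
  assume sol: "solves (orbit_equation \<delta>) (cub a b c d)"
  obtain g :: "complex^2^2" where g: "det g \<noteq> 0" "\<And>v. cub a b c d (g *v v) = cub 1 0 0 1 v"
    using cub_normal_form[OF assms] by blast
  \<comment> \<open>One point where neither the cubic nor its Hessian vanishes suffices. In normal
    form these are x^3 + y^3 and xy, both nonzero at (1, 1).\<close>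
  define p where "p = g *v vector [1, 1]"
  have "cub a b c d p \<noteq> 0"
    by (simp add: p_def g(2)) (simp add: cub_def)
  moreover have "hess 1 0 0 1 (vector [1, 1]) = (det g)\<^sup>2 * hess a b c d p"
    unfolding p_def using hess_cub_subst(1)[OF g(2)] .
  then have "hess a b c d p \<noteq> 0"
    by (auto simp: quad_def)
  ultimately have "cub_disc a b c d = \<delta> / 81"
    using sol by (auto simp: solves_def orbit_equation_cub)
  then show "discr3 (cub a b c d) = \<delta>"
    by (simp only: discr3_cub) simp
next
  assume "discr3 (cub a b c d) = \<delta>"
  then have "\<delta> = 81 * cub_disc a b c d"
    by (simp add: discr3_cub)
  then show "solves (orbit_equation \<delta>) (cub a b c d)"
    by (simp add: solves_def orbit_equation_cub)
qed

section \<open>Orbits\<close>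

lemma sum_of_cubes_stabilizer:
  fixes \<zeta> :: complex
  assumes "\<zeta> ^ 6 = 1"
  obtains k :: "complex^2^2" where "det k = \<zeta>" "\<And>v. cub 1 0 0 1 (k *v v) = cub 1 0 0 1 v"
proof -
  have "(\<zeta> ^ 3 - 1) * (\<zeta> ^ 3 + 1) = 0"
    using assms by algebra
  then consider "\<zeta> ^ 3 = 1" | "\<zeta> ^ 3 = - 1"
    by (auto simp: eq_neg_iff_add_eq_0)
  then show thesis
  proof cases
    case 1
    show thesis
      by (rule that[of "vector [vector [\<zeta>, 0], vector [0, 1]]"])
        (use 1 in \<open>simp_all add: det_2 cub_def matrix_vector_mult_def sum_2 power_mult_distrib\<close>)
  next
    case 2
    \<comment> \<open>Now -\<zeta> is a cube root of unity, and exchanging the variables restores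
      the sign of the determinant.\<close>
    show thesis
      by (rule that[of "vector [vector [0, - \<zeta>], vector [1, 0]]"])
        (use 2 in \<open>simp_all add: det_2 cub_def matrix_vector_mult_def sum_2 power_mult_distrib\<close>)
  qed
qed

lemma SL2_invertible: "A \<in> SL2 \<Longrightarrow> invertible A"
  by (simp add: SL2_def invertible_det_nz)

lemma matrix_inv_SL2:
  assumes "A \<in> SL2"
  shows "A ** matrix_inv A = mat 1" "matrix_inv A ** A = mat 1" "det (matrix_inv A) = 1"
proof -
  have "A ** matrix_inv A = mat 1 \<and> matrix_inv A ** A = mat 1"
    using SL2_invertible[OF assms] unfolding invertible_def matrix_inv_def by (rule someI_ex)
  then show *: "A ** matrix_inv A = mat 1" "matrix_inv A ** A = mat 1"
    by auto
  have "det A * det (matrix_inv A) = 1"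
    using arg_cong[OF *(1), of det] by (simp add: det_mul)
  then show "det (matrix_inv A) = 1"
    using assms by (simp add: SL2_def)
qed

text \<open>As \<open>act\<close> substitutes the inverse matrix, this criterion lets orbit
  membership be shown without \<open>matrix_inv\<close>.\<close>

lemma SL2_orbitI:
  assumes "A \<in> SL2" "\<And>v. \<psi> (A *v v) = \<phi> v"
  shows "\<psi> \<in> SL2_orbit \<phi>"
proof -
  have "act A \<phi> v = \<psi> v" for v
    using assms(2)[of "matrix_inv A *v v"] matrix_inv_SL2(1)[OF assms(1)]
    by (simp add: act_def matrix_vector_mul_assoc)
  then have "\<psi> = act A \<phi>" by auto
  then show ?thesis
    using assms(1) by (auto simp: SL2_orbit_def)
qed

lemma SL2_orbit_cub_iff:
  assumes "cub_disc a b c d \<noteq> 0"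
  shows "\<psi> \<in> SL2_orbit (cub a b c d) \<longleftrightarrow>
    (\<exists>a' b' c' d'. \<psi> = cub a' b' c' d' \<and> cub_disc a' b' c' d' = cub_disc a b c d)"
proof
  assume "\<psi> \<in> SL2_orbit (cub a b c d)"
  then obtain A where A: "A \<in> SL2" and \<psi>: "\<And>v. \<psi> v = cub a b c d (matrix_inv A *v v)"
    by (auto simp: SL2_orbit_def act_def)
  obtain a' b' c' d' where "\<And>v. cub a b c d (matrix_inv A *v v) = cub a' b' c' d' v"
    "cub_disc a' b' c' d' = det (matrix_inv A) ^ 6 * cub_disc a b c d"
    by (rule cub_subst[of a b c d "matrix_inv A"]) blast
  with \<psi> matrix_inv_SL2(3)[OF A]
  show "\<exists>a' b' c' d'. \<psi> = cub a' b' c' d' \<and> cub_disc a' b' c' d' = cub_disc a b c d"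
    by (intro exI[of _ a'] exI[of _ b'] exI[of _ c'] exI[of _ d']) (auto simp: fun_eq_iff)
next
  assume "\<exists>a' b' c' d'. \<psi> = cub a' b' c' d' \<and> cub_disc a' b' c' d' = cub_disc a b c d"
  then obtain a' b' c' d' where \<psi>: "\<psi> = cub a' b' c' d'"
    and disc: "cub_disc a' b' c' d' = cub_disc a b c d" by blast
  obtain g :: "complex^2^2" where g: "det g \<noteq> 0" "\<And>v. cub a b c d (g *v v) = cub 1 0 0 1 v"
    using cub_normal_form[OF assms] by blast
  obtain h :: "complex^2^2" where h: "det h \<noteq> 0" "\<And>v. cub a' b' c' d' (h *v v) = cub 1 0 0 1 v"
    using cub_normal_form[of a' b' c' d'] assms disc by auto
  \<comment> \<open>By weight 6, both sides equal the discriminant of x^3 + y^3.\<close>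
  have "det g ^ 6 * cub_disc a b c d = det h ^ 6 * cub_disc a b c d"
    using hess_cub_subst(2)[OF g(2)] hess_cub_subst(2)[OF h(2)] disc by argo
  then have "(det g / det h) ^ 6 = 1"
    using assms h(1) by (simp add: power_divide)
  then obtain k :: "complex^2^2" where k: "det k = det g / det h"
    "\<And>v. cub 1 0 0 1 (k *v v) = cub 1 0 0 1 v"
    using sum_of_cubes_stabilizer by blast
  obtain g' where g': "g ** g' = mat 1" "g' ** g = mat 1"
    using g(1) by (auto simp: invertible_det_nz[symmetric] invertible_def)
  have det_g': "det g * det g' = 1"
    using arg_cong[OF g'(1), of det] by (simp add: det_mul)
  show "\<psi> \<in> SL2_orbit (cub a b c d)"
  proof (rule SL2_orbitI)
    \<comment> \<open>The path goes from \<psi> to x^3 + y^3 by h, stays there under k, and reaches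
      \<phi> by the inverse of g; the choice of det k makes the total determinant 1.\<close>
    show "h ** k ** g' \<in> SL2"
      using h(1) det_g' by (simp add: SL2_def det_mul k(1))
    show "\<psi> ((h ** k ** g') *v v) = cub a b c d v" for v
    proof -
      have "\<psi> ((h ** k ** g') *v v) = cub a' b' c' d' (h *v (k *v (g' *v v)))"
        by (simp add: \<psi> matrix_vector_mul_assoc matrix_mul_assoc)
      also have "\<dots> = cub a b c d (g *v (g' *v v))"
        by (simp add: h(2) k(2) g(2))
      also have "\<dots> = cub a b c d v"
        by (simp add: matrix_vector_mul_assoc g'(1))
      finally show ?thesis .
    qed
  qed
qed

text \<open>Regularity of \<psi> excludes degenerate solutions: the Hessian of the cube of a linear
  form is identically zero, so such a cube satisfies both systems without lying in the
  orbit.\<close>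

theorem theorem14:
  fixes \<phi> :: "complex^2 \<Rightarrow> complex"
  assumes "binary_form 3 \<phi>" and "discr3 \<phi> \<noteq> 0"
  shows "SL2_orbit \<phi> =
    {\<psi>. binary_form 3 \<psi> \<and> discr3 \<psi> \<noteq> 0 \<and>
         solves (orbit_equation (discr3 \<phi>)) \<psi> \<and> solves_E3 \<psi>}"
proof -
  obtain a b c d where \<phi>: "\<phi> = cub a b c d"
    using assms(1) by (auto simp: binary_form_3_iff)
  have nz: "cub_disc a b c d \<noteq> 0"
    using assms(2) by (simp add: \<phi> discr3_cub)
  have "\<psi> \<in> SL2_orbit \<phi> \<longleftrightarrow> binary_form 3 \<psi> \<and> discr3 \<psi> \<noteq> 0 \<and>
      solves (orbit_equation (discr3 \<phi>)) \<psi> \<and> solves_E3 \<psi>" for \<psi>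
  proof
    assume "\<psi> \<in> SL2_orbit \<phi>"
    then obtain a' b' c' d' where \<psi>: "\<psi> = cub a' b' c' d'"
      and disc: "cub_disc a' b' c' d' = cub_disc a b c d"
      using SL2_orbit_cub_iff[OF nz] by (auto simp: \<phi>)
    have "solves (orbit_equation (discr3 \<phi>)) \<psi>"
      unfolding \<psi> using nz disc
      by (subst solves_orbit_equation_cub_iff) (simp_all add: \<phi> discr3_cub)
    then show "binary_form 3 \<psi> \<and> discr3 \<psi> \<noteq> 0 \<and>
        solves (orbit_equation (discr3 \<phi>)) \<psi> \<and> solves_E3 \<psi>"
      using nz disc solves_E3_cub by (auto simp: \<psi> binary_form_3_iff discr3_cub)
  next
    assume *: "binary_form 3 \<psi> \<and> discr3 \<psi> \<noteq> 0 \<and>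
        solves (orbit_equation (discr3 \<phi>)) \<psi> \<and> solves_E3 \<psi>"
    then obtain a' b' c' d' where \<psi>: "\<psi> = cub a' b' c' d'"
      by (auto simp: binary_form_3_iff)
    have "cub_disc a' b' c' d' \<noteq> 0"
      using * by (simp add: \<psi> discr3_cub)
    then have "cub_disc a' b' c' d' = cub_disc a b c d"
      using * solves_orbit_equation_cub_iff by (auto simp: \<psi> \<phi> discr3_cub)
    then show "\<psi> \<in> SL2_orbit \<phi>"
      using SL2_orbit_cub_iff[OF nz] \<psi> \<phi> by blast
  qed
  then show ?thesis by blast
qed

end
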